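(* Let $X$ be a Tychonoff space. Every prime ideal of the semiring $C_{+}(X)$ is a prime clique in $\Gamma(C_{+}(X))$.
   Context: For a Tychonoff space $X$, $C_{+}(X)$ is the commutative semiring of non-negative real-valued continuous functions on $X$ with pointwise operations. An ideal of a commutative semiring $S$ is a nonempty subset $I$ with $a+b\in I$ and $as\in I$ for all $a,b\in I$, $s\in S$; a prime ideal is a proper ideal $I$ such that $ab\in I$ implies $a\in I$ or $b\in I$. For $f\in C_{+}(X)$, $Z(f)=\{x\in X: f(x)=0\}$, and $\mathcal{N}'(X)$ is the set of non-units of $C_{+}(X)$ (functions with $Z(f)\neq\emptyset$). The zero-set intersection graph $\Gamma(C_{+}(X))$ has vertex set $\mathcal{N}'(X)$, with distinct vertices $f,g$ adjacent iff $Z(f)\cap Z(g)\neq\emptyset$. A clique is a nonempty set of vertices any two distinct members of which are adjacent. A clique $I$ in a graph $G$ is a prime clique if any two (distinct) vertices $f,g\in G\setminus I$ that are adjacent to all elements of $I$ are adjacent to each other. *)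

theory Defs
  imports "HOL-Analysis.Analysis" "HOL-Algebra.Ring"
begin

definition tychonoff_space :: "'a topology \<Rightarrow> bool" where
  "tychonoff_space X \<longleftrightarrow> completely_regular_space X \<and> Hausdorff_space X"

text \<open>
  The predicates \<open>ideal\<close> and \<open>primeideal\<close> of HOL-Algebra assume a ring (an ideal there is an
  additive subgroup), so the semiring notions are defined here, on the same record type. They are
  meant for records satisfying the locales \<open>semiring\<close> and \<open>comm_monoid\<close>.
\<close>

definition semiring_ideal :: "('a, 'm) ring_scheme \<Rightarrow> 'a set \<Rightarrow> bool" where
  "semiring_ideal S I \<longleftrightarrow>
     I \<subseteq> carrier S \<and> I \<noteq> {} \<and>
     (\<forall>a\<in>I. \<forall>b\<in>I. a \<oplus>\<^bsub>S\<^esub> b \<in> I) \<and>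
     (\<forall>a\<in>I. \<forall>s\<in>carrier S. a \<otimes>\<^bsub>S\<^esub> s \<in> I)"

definition semiring_prime_ideal :: "('a, 'm) ring_scheme \<Rightarrow> 'a set \<Rightarrow> bool" where
  "semiring_prime_ideal S I \<longleftrightarrow>
     semiring_ideal S I \<and> I \<noteq> carrier S \<and>
     (\<forall>a\<in>carrier S. \<forall>b\<in>carrier S. a \<otimes>\<^bsub>S\<^esub> b \<in> I \<longrightarrow> a \<in> I \<or> b \<in> I)"

definition non_units :: "('a, 'm) ring_scheme \<Rightarrow> 'a set" where
  "non_units S = carrier S - Units S"

text \<open>
  A function on the space \<open>X\<close> is represented by a HOL function that is \<open>undefined\<close> outside
  \<open>topspace X\<close>, so that equality in the carrier is equality of functions on \<open>X\<close>.
\<close>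

definition C_plus :: "'a topology \<Rightarrow> ('a \<Rightarrow> real) ring" where
  "C_plus X =
     \<lparr> carrier = {f \<in> extensional (topspace X).
                    continuous_map X euclideanreal f \<and> (\<forall>x\<in>topspace X. 0 \<le> f x)},
       mult = (\<lambda>f g. restrict (\<lambda>x. f x * g x) (topspace X)),
       one = restrict (\<lambda>x. 1) (topspace X),
       zero = restrict (\<lambda>x. 0) (topspace X),
       add = (\<lambda>f g. restrict (\<lambda>x. f x + g x) (topspace X)) \<rparr>"

lemma C_plus_semiring: "semiring (C_plus X)"
proof -
  have cont: "continuous_map X euclideanreal (restrict f (topspace X))"
    if "continuous_map X euclideanreal f" for f
    using that by (rule continuous_map_eq) simp
  have "abelian_monoid (C_plus X)"
    by (rule abelian_monoidI)
      (auto simp: C_plus_def fun_eq_iff extensional_def algebra_simps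
        intro!: cont continuous_map_add)
  moreover have "monoid (C_plus X)"
    by (rule monoidI)
      (auto simp: C_plus_def fun_eq_iff extensional_def algebra_simps
        intro!: cont continuous_map_real_mult)
  moreover have "semiring_axioms (C_plus X)"
    by unfold_locales (auto simp: C_plus_def fun_eq_iff algebra_simps)
  ultimately show ?thesis
    by (rule semiring.intro)
qed

lemma C_plus_comm_monoid: "comm_monoid (C_plus X)"
proof -
  interpret semiring "C_plus X" by (rule C_plus_semiring)
  show ?thesis
    by unfold_locales (auto simp: C_plus_def mult.commute)
qed

definition zero_set :: "'a topology \<Rightarrow> ('a \<Rightarrow> real) \<Rightarrow> 'a set" where
  "zero_set X f = {x \<in> topspace X. f x = 0}"

record 'v graph =
  vertices :: "'v set"
  adjacent :: "'v \<Rightarrow> 'v \<Rightarrow> bool"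

definition clique :: "'v graph \<Rightarrow> 'v set \<Rightarrow> bool" where
  "clique G I \<longleftrightarrow>
     I \<subseteq> vertices G \<and> I \<noteq> {} \<and> (\<forall>u\<in>I. \<forall>v\<in>I. u \<noteq> v \<longrightarrow> adjacent G u v)"

definition prime_clique :: "'v graph \<Rightarrow> 'v set \<Rightarrow> bool" where
  "prime_clique G I \<longleftrightarrow>
     clique G I \<and>
     (\<forall>u\<in>vertices G - I. \<forall>v\<in>vertices G - I.
        u \<noteq> v \<longrightarrow> (\<forall>w\<in>I. adjacent G u w) \<longrightarrow> (\<forall>w\<in>I. adjacent G v w) \<longrightarrow> adjacent G u v)"

definition zero_set_graph :: "'a topology \<Rightarrow> ('a \<Rightarrow> real) graph" where
  "zero_set_graph X =
     \<lparr> vertices = non_units (C_plus X),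
       adjacent = (\<lambda>f g. f \<in> non_units (C_plus X) \<and> g \<in> non_units (C_plus X) \<and>
                         f \<noteq> g \<and> zero_set X f \<inter> zero_set X g \<noteq> {}) \<rparr>"

end

theory Submission
  imports Defs
begin

text \<open>
  For \<open>f\<close> and \<open>g\<close> in the prime ideal, \<open>Z(f) \<inter> Z(g) = Z(f + g)\<close> is nonempty because \<open>f + g\<close> is
  a non-unit. For \<open>f\<close> and \<open>g\<close> outside it, the functions \<open>max (f - g) 0\<close> and \<open>max (g - f) 0\<close> have
  product \<open>0\<close>, so one of them, say the latter, lies in the ideal. Its zero set is \<open>{g \<le> f}\<close>, and
  by assumption this set meets \<open>Z(f)\<close>; at a common point \<open>g\<close> vanishes as well.
\<close>

text \<open>Multiplying a unit of the ideal by its inverse would put 1, and hence every element,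
  into the ideal, against properness.\<close>

lemma semiring_prime_ideal_non_units:
  assumes "monoid S" and P: "semiring_prime_ideal S P"
  shows "P \<subseteq> non_units S"
proof
  interpret monoid S by fact
  fix f assume f: "f \<in> P"
  have sub: "P \<subseteq> carrier S" and ne: "P \<noteq> carrier S"
    and mult: "\<And>a s. a \<in> P \<Longrightarrow> s \<in> carrier S \<Longrightarrow> a \<otimes>\<^bsub>S\<^esub> s \<in> P"
    using P by (auto simp: semiring_prime_ideal_def semiring_ideal_def)
  have "f \<notin> Units S"
  proof
    assume "f \<in> Units S"
    then have "\<one>\<^bsub>S\<^esub> \<in> P"
      using mult[OF f, of "inv\<^bsub>S\<^esub> f"] by simp
    then have "carrier S \<subseteq> P"
      using mult[of "\<one>\<^bsub>S\<^esub>"] by force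
    with sub ne show False by blast
  qed
  with f sub show "f \<in> non_units S"
    by (auto simp: non_units_def)
qed

lemma restrict_in_C_plus:
  assumes "continuous_map X euclideanreal f" and "\<And>x. x \<in> topspace X \<Longrightarrow> 0 \<le> f x"
  shows "restrict f (topspace X) \<in> carrier (C_plus X)"
proof -
  have "continuous_map X euclideanreal (restrict f (topspace X))"
    using assms(1) by (rule continuous_map_eq) simp
  with assms(2) show ?thesis
    by (simp add: C_plus_def)
qed

text \<open>If \<open>f\<close> vanished nowhere, its pointwise reciprocal would be continuous and
  non-negative, hence an inverse of \<open>f\<close> in the semiring.\<close>

lemma zero_set_non_unit:
  assumes "f \<in> non_units (C_plus X)"
  shows "zero_set X f \<noteq> {}"
proof
  assume "zero_set X f = {}"
  then have nz: "\<And>x. x \<in> topspace X \<Longrightarrow> f x \<noteq> 0"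
    by (auto simp: zero_set_def)
  have f: "f \<in> carrier (C_plus X)" and nu: "f \<notin> Units (C_plus X)"
    using assms by (auto simp: non_units_def)
  define g where "g = restrict (\<lambda>x. inverse (f x)) (topspace X)"
  have g: "g \<in> carrier (C_plus X)"
    unfolding g_def using f nz
    by (intro restrict_in_C_plus continuous_map_real_inverse) (auto simp: C_plus_def)
  have "f \<otimes>\<^bsub>C_plus X\<^esub> g = \<one>\<^bsub>C_plus X\<^esub>" "g \<otimes>\<^bsub>C_plus X\<^esub> f = \<one>\<^bsub>C_plus X\<^esub>"
    using nz by (auto simp: C_plus_def g_def fun_eq_iff)
  with f g nu show False
    by (auto simp: Units_def)
qed

text \<open>Values are non-negative, so no cancellation can occur in a sum.\<close>

lemma zero_set_add:
  assumes "f \<in> carrier (C_plus X)" and "g \<in> carrier (C_plus X)"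
  shows "zero_set X (f \<oplus>\<^bsub>C_plus X\<^esub> g) = zero_set X f \<inter> zero_set X g"
  using assms by (auto simp: zero_set_def C_plus_def add_nonneg_eq_0_iff)

lemma prime_ideal_zero_sets_meet:
  assumes "semiring_prime_ideal (C_plus X) P" and "f \<in> P" and "g \<in> P"
  shows "zero_set X f \<inter> zero_set X g \<noteq> {}"
proof -
  interpret semiring "C_plus X" by (rule C_plus_semiring)
  have "f \<oplus>\<^bsub>C_plus X\<^esub> g \<in> P" "f \<in> carrier (C_plus X)" "g \<in> carrier (C_plus X)"
    using assms by (auto simp: semiring_prime_ideal_def semiring_ideal_def)
  with semiring_prime_ideal_non_units[OF monoid_axioms assms(1)] show ?thesis
    using zero_set_non_unit zero_set_add by blast
qed

text \<open>The product condition on prime ideals enters here, applied to a factorization of the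
  zero function.\<close>

lemma prime_ideal_contains_positive_part_of_diff:
  assumes P: "semiring_prime_ideal (C_plus X) P"
    and f: "f \<in> carrier (C_plus X)" and g: "g \<in> carrier (C_plus X)"
  shows "restrict (\<lambda>x. max (f x - g x) 0) (topspace X) \<in> P \<or>
         restrict (\<lambda>x. max (g x - f x) 0) (topspace X) \<in> P"
    (is "?a \<in> P \<or> ?b \<in> P")
proof -
  interpret semiring "C_plus X" by (rule C_plus_semiring)
  \<comment> \<open>The definition of an ideal does not list zero as a member; it arises as
    \<open>p\<close> times zero for any member \<open>p\<close>.\<close>
  obtain p where "p \<in> P" "p \<in> carrier (C_plus X)"
    using P by (auto simp: semiring_prime_ideal_def semiring_ideal_def)
  then have "p \<otimes>\<^bsub>C_plus X\<^esub> \<zero>\<^bsub>C_plus X\<^esub> \<in> P"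
    using P zero_closed unfolding semiring_prime_ideal_def semiring_ideal_def by blast
  then have zero: "\<zero>\<^bsub>C_plus X\<^esub> \<in> P"
    using \<open>p \<in> carrier (C_plus X)\<close> by simp
  have cont: "continuous_map X euclideanreal f" "continuous_map X euclideanreal g"
    using f g by (auto simp: C_plus_def)
  have ab: "?a \<in> carrier (C_plus X)" "?b \<in> carrier (C_plus X)"
    by (intro restrict_in_C_plus continuous_map_real_max continuous_map_diff cont; simp)+
  \<comment> \<open>At each point one of the two differences is at most 0, so one of the factors
    vanishes there.\<close>
  have "?a \<otimes>\<^bsub>C_plus X\<^esub> ?b = \<zero>\<^bsub>C_plus X\<^esub>"
    by (auto simp: C_plus_def fun_eq_iff max_def)
  with zero ab P show ?thesis
    unfolding semiring_prime_ideal_def by metis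
qed

text \<open>Where \<open>f\<close> vanishes, the positive part of \<open>g - f\<close> is that of
  \<open>g\<close>, which is \<open>g\<close> itself because \<open>g\<close> is
  non-negative.\<close>

lemma zero_sets_meet_of_positive_part:
  assumes "g \<in> carrier (C_plus X)"
    and "zero_set X f \<inter> zero_set X (restrict (\<lambda>x. max (g x - f x) 0) (topspace X)) \<noteq> {}"
  shows "zero_set X f \<inter> zero_set X g \<noteq> {}"
proof -
  obtain x where x: "x \<in> topspace X" "f x = 0" "max (g x - f x) 0 = 0"
    using assms(2) by (auto simp: zero_set_def)
  moreover have "0 \<le> g x"
    using assms(1) x by (simp add: C_plus_def)
  ultimately have "g x = 0" by linarith
  with x show ?thesis by (auto simp: zero_set_def)
qed

theorem theorem3p15:
  fixes X :: "'a topology" and P :: "('a \<Rightarrow> real) set"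
  assumes "tychonoff_space X"
    and "semiring_prime_ideal (C_plus X) P"
  shows "prime_clique (zero_set_graph X) P"
proof -
  interpret semiring "C_plus X" by (rule C_plus_semiring)
  have nu: "P \<subseteq> non_units (C_plus X)"
    using semiring_prime_ideal_non_units[OF monoid_axioms assms(2)] .
  have "P \<noteq> {}"
    using assms(2) by (simp add: semiring_prime_ideal_def semiring_ideal_def)
  then have "clique (zero_set_graph X) P"
    using nu prime_ideal_zero_sets_meet[OF assms(2)]
    by (auto simp: clique_def zero_set_graph_def)
  \<comment> \<open>This isolates the zero-set part of adjacency; the remaining conjuncts, being
    non-units and distinct, come from the definition of a prime clique.\<close>
  moreover have "zero_set X f \<inter> zero_set X g \<noteq> {}"
    if "f \<in> non_units (C_plus X)" "g \<in> non_units (C_plus X)"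
      and "\<forall>w\<in>P. zero_set X f \<inter> zero_set X w \<noteq> {}"
      and "\<forall>w\<in>P. zero_set X g \<inter> zero_set X w \<noteq> {}" for f g
  proof -
    have fg: "f \<in> carrier (C_plus X)" "g \<in> carrier (C_plus X)"
      using that by (auto simp: non_units_def)
    show ?thesis
      using prime_ideal_contains_positive_part_of_diff[OF assms(2) fg]
    proof
      \<comment> \<open>Here \<open>f\<close> and \<open>g\<close> swap roles: the zero set of this
        function is where \<open>f <= g\<close>, and it meets the zero set of
        \<open>g\<close>.\<close>
      assume "restrict (\<lambda>x. max (f x - g x) 0) (topspace X) \<in> P"
      then have "zero_set X g \<inter> zero_set X f \<noteq> {}"
        using that(4) zero_sets_meet_of_positive_part[OF fg(1)] by blast
      then show ?thesis by (simp add: Int_commute)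
    next
      assume "restrict (\<lambda>x. max (g x - f x) 0) (topspace X) \<in> P"
      then show ?thesis
        using that(3) zero_sets_meet_of_positive_part[OF fg(2)] by blast
    qed
  qed
  ultimately show ?thesis
    by (simp add: prime_clique_def zero_set_graph_def)
qed

end
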